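(* Fix parameters $\sigma>\frac12$ and $0<\gamma<\frac{2\sigma-1}{2\sigma}$. Let $\{x_k\}_{k\ge0}$ be generated by the projected subgradient method with initial point $x_0\in\mathcal{T}_\gamma$ and the Scaled Polyak step-size $\alpha_k=\frac{f(x_k)-f^*}{\sigma\|\zeta_k\|}$. Then the following assertions hold: (a) For each integer $k\ge0$, $x_k\in\mathcal{T}_\gamma$ and $$\operatorname{dist}^2(x_{k+1};\mathcal{X}^* )\le\Big(1-\big(2\sigma(1-\gamma)-1\big)\sigma^{-2}\tau_k^2\Big)\operatorname{dist}^2(x_k;\mathcal{X}^* ),$$ where $\tau_k:=\tau\operatorname{dist}^{\frac1\delta-1}(x_k;\mathcal{X}^* )$. (b) The sequence $\{\operatorname{dist}(x_k;\mathcal{X}^* )\}_{k\ge0}$ either converges to zero in a finite number of steps or converges to zero monotonically, and $\lim_{k\to\infty}f(x_k)=f^*$. (c) If $\delta=1$, the sequence $\{\operatorname{dist}(x_k;\mathcal{X}^* )\}_{k\ge0}$ converges Q-linearly (to zero) with rate $\sqrt{1-\big(2\sigma(1-\gamma)-1\big)\sigma^{-2}\tau^2}$. (d) If $\frac1{1+\nu}<\delta<1$, the sequence $\{\operatorname{dist}(x_k;\mathcal{X}^* )\}_{k\ge0}$ converges sublinearly, i.e., there exists $\eta>0$ such that $\operatorname{dist}^2(x_k;\mathcal{X}^* )\le\eta k^{-\frac{\delta}{1-\delta}}$ for all sufficiently large $k\in\mathbb{N}$. (e) For each $k\in\mathbb{N}$, with $f_k^*:=\min\{f(x_i):i=0,1,\dots,k\}$,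 $$f_k^*-f^*\le\frac{\sigma L\operatorname{dist}(x_0;\mathcal{X}^* )}{\sqrt{2\sigma(1-\gamma)-1}\,\sqrt{k+1}}.$$
   Context: $\|\cdot\|$ is the Euclidean norm on $\mathbb{R}^n$, $\operatorname{dist}(x;S)=\inf_{z\in S}\|z-x\|$, $\operatorname{proj}_X$ is the Euclidean projection onto $X$, $\operatorname{dom}(f)=\{x:f(x)<+\infty\}$, and $\partial f$ is the Clarke subdifferential. Standing assumptions: $f:\mathbb{R}^n\to\mathbb{R}\cup\{+\infty\}$ is proper; $X\subseteq\operatorname{dom}(f)$ is nonempty, closed and convex; the set of minimizers $\mathcal{X}^*=\operatorname{argmin}_{x\in X}f(x)$ is nonempty and $f^*$ is the minimal value of $f$ over $X$. The parameters satisfy $\rho>0$, $0<\nu\le1$, $\frac1{1+\nu}<\delta\le1$, $\mu>0$, and: (i) $f$ is $\nu$-paraconvex with constant $\rho$ on an open convex set $X'$ with $X\subseteq X'\subseteq\operatorname{dom}(f)$, i.e. $f(\lambda x+(1-\lambda)y)\le\lambda f(x)+(1-\lambda)f(y)+\rho\min\{\lambda,1-\lambda\}\|x-y\|^{1+\nu}$ for all $x,y\in X'$, $\lambda\in[0,1]$ (consequently $f$ is locally Lipschitz on $X'$); (ii) Hölderian error bound: $\mu\operatorname{dist}^{1/\delta}(x;\mathcal{X}^* )\le f(x)-f^*$ for all $x\in X$. For $\gamma\in(0,1]$ let $\mathcal{T}_\gamma=\big\{x\in X:\operatorname{dist}(x;\mathcal{X}^* )<(\gamma\mu/\rho)^{\delta/(\delta(1+\nu)-1)}\big\}$.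 Let $L=\sup\{\|\zeta\|:\zeta\in\partial f(x),\ x\in\mathcal{T}_1\}$, with $0<L<\infty$, and $\tau=\mu/L$. Projected subgradient method with step-sizes $\alpha_k$: from the initial point, at each iteration choose any $\zeta_k\in\partial f(x_k)$ and set $x_{k+1}=\operatorname{proj}_X\big(x_k-\alpha_k\zeta_k/\|\zeta_k\|\big)$; if $\zeta_k=0$, set $x_{k+1}=x_k$. A nonnegative sequence $\{s_k\}$ converges Q-linearly to zero with rate $c\in[0,1)$ if $s_{k+1}\le c\,s_k$ for all $k$.
   Formalization: In (c), the case where every point of X is a minimizer and 1-(2σ(1-γ)-1)σ^{-2}τ² is negative is excluded, since the stated rate is then not a real number (e.g. X={0}, f(x)=x, ν=δ=σ=1, γ=1/4, μ=100). *)

theory Defs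
  imports "HOL-Analysis.Analysis"
begin

definition effective_domain :: "('a \<Rightarrow> ereal) \<Rightarrow> 'a set" where
  "effective_domain f = {x. f x < \<infinity>}"

definition proper_fun :: "('a \<Rightarrow> ereal) \<Rightarrow> bool" where
  "proper_fun f \<longleftrightarrow> (\<forall>x. f x \<noteq> -\<infinity>) \<and> effective_domain f \<noteq> {}"

definition minimizers :: "('a \<Rightarrow> ereal) \<Rightarrow> 'a set \<Rightarrow> 'a set" where
  "minimizers f X = {x. is_arg_min f (\<lambda>y. y \<in> X) x}"

definition paraconvex_on ::
  "'a::real_normed_vector set \<Rightarrow> ('a \<Rightarrow> ereal) \<Rightarrow> real \<Rightarrow> real \<Rightarrow> bool" where
  "paraconvex_on C f \<nu> \<rho> \<longleftrightarrow>
     (\<forall>x\<in>C. \<forall>y\<in>C. \<forall>t\<in>{0..1}.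
        f (t *\<^sub>R x + (1 - t) *\<^sub>R y)
          \<le> ereal t * f x + ereal (1 - t) * f y
             + ereal (\<rho> * min t (1 - t) * norm (x - y) powr (1 + \<nu>)))"

(* Limsup of the difference quotients as y tends to x (y = x allowed) and, independently,
   t tends to 0 from the right. *)
definition clarke_dir_deriv ::
  "('a::real_normed_vector \<Rightarrow> ereal) \<Rightarrow> 'a \<Rightarrow> 'a \<Rightarrow> ereal" where
  "clarke_dir_deriv f x v =
     Limsup (nhds x \<times>\<^sub>F at_right (0::real))
       (\<lambda>(y, t). (f (y + t *\<^sub>R v) - f y) / ereal t)"

(* This is the Clarke subdifferential at points having a neighbourhood on which f is finite
   and Lipschitz.  Elsewhere Clarke's notion is defined through normal cones to the epigraph
   and need not agree with this set. *)
definition clarke_subdiff :: "('a::real_inner \<Rightarrow> ereal) \<Rightarrow> 'a \<Rightarrow> 'a set" where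
  "clarke_subdiff f x = {\<zeta>. \<forall>v. ereal (\<zeta> \<bullet> v) \<le> clarke_dir_deriv f x v}"

definition tube ::
  "('a::metric_space \<Rightarrow> ereal) \<Rightarrow> 'a set \<Rightarrow> real \<Rightarrow> real \<Rightarrow> real \<Rightarrow> real \<Rightarrow> real \<Rightarrow> 'a set" where
  "tube f X \<mu> \<rho> \<nu> \<delta> \<gamma> =
     {x \<in> X. infdist x (minimizers f X) < (\<gamma> * \<mu> / \<rho>) powr (\<delta> / (\<delta> * (1 + \<nu>) - 1))}"

(* The choice of each subgradient is recorded by the sequence z. *)
definition projected_subgradient ::
  "('a::euclidean_space \<Rightarrow> ereal) \<Rightarrow> 'a set \<Rightarrow> (nat \<Rightarrow> real) \<Rightarrow> (nat \<Rightarrow> 'a) \<Rightarrow> (nat \<Rightarrow> 'a) \<Rightarrow> bool"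
  where
  "projected_subgradient f X \<alpha> x z \<longleftrightarrow>
     (\<forall>k. z k \<in> clarke_subdiff f (x k) \<and>
          x (Suc k) =
            (if z k = 0 then x k
             else closest_point X (x k - \<alpha> k *\<^sub>R (z k /\<^sub>R norm (z k)))))"

definition Q_linear_to_zero :: "(nat \<Rightarrow> real) \<Rightarrow> real \<Rightarrow> bool" where
  "Q_linear_to_zero s c \<longleftrightarrow>
     0 \<le> c \<and> c < 1 \<and> (\<forall>k. 0 \<le> s k) \<and> (\<forall>k. s (Suc k) \<le> c * s k)"

end

theory Submission
  imports Defs
begin

text \<open>
  Clarke subgradients of a paraconvex function satisfy the subgradient inequality of convex analysis
  up to an error \<rho> * dist^(1 + \<nu>) (\<open>paraconvex_subgradient_ineq\<close>).  The radius of the tube is chosen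
  such that, with respect to the nearest minimizer, this error is at most the fraction \<gamma> of the
  growth \<mu> * dist^(1 / \<delta>), hence of the gap F = f x - fstar by the error bound
  (\<open>growth_dominates_in_tube\<close>).  Thus the classical computation for Polyak's step length goes
  through with (1 - \<gamma>) * F in place of F and gives the basic estimate
  (\<open>scaled_Polyak_step_decrease\<close>), with D the distance to the minimizers:

    D (Suc k)^2 \<le> D k^2 - c / (\<sigma> * L)^2 * F k^2,  where c = 2 * \<sigma> * (1 - \<gamma>) - 1 > 0.

  Everything else is read off from this.  The distance never increases, so the tube is not left.
  Estimating F k from below by the error bound yields the contraction of the distance; for \<delta> = 1
  its factor is constant, and for \<delta> < 1 it is a recursion s - A * s^(1 + q) for s = D^2 with q = 1 / \<delta> - 1, whose
  solutions decay like k^(- 1 / q) (\<open>superlinear_recursion_decay\<close>).  Summing the estimate over k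
  shows that the squares of the gaps are summable, which gives both the convergence of f (x k) and
  the bound on the best value.

  The analytic part is the theory of paraconvex functions: they are continuous on open convex sets,
  which the subgradient inequality rests on, and they have Clarke subgradients at every point
  (\<open>paraconvex_clarke_subdiff_nonempty\<close>).  Existence is needed only to see that the radicand in the
  linear rate is nonnegative when the sequence starts at a minimizer.
\<close>

section \<open>Continuity of paraconvex functions\<close>

lemma paraconvex_onD:
  assumes "paraconvex_on C (\<lambda>y. ereal (g y)) \<nu> \<rho>" and "x \<in> C" "y \<in> C" "0 \<le> t" "t \<le> 1"
  shows "g (t *\<^sub>R x + (1 - t) *\<^sub>R y)
     \<le> t * g x + (1 - t) * g y + \<rho> * min t (1 - t) * norm (x - y) powr (1 + \<nu>)"
proof -
  have "ereal (g (t *\<^sub>R x + (1 - t) *\<^sub>R y)) \<le> ereal t * ereal (g x) + ereal (1 - t) * ereal (g y)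
      + ereal (\<rho> * min t (1 - t) * norm (x - y) powr (1 + \<nu>))"
    using assms unfolding paraconvex_on_def by (meson atLeastAtMost_iff)
  then show ?thesis by simp
qed

lemma paraconvex_on_cong:
  assumes "convex C" and "\<And>y. y \<in> C \<Longrightarrow> f y = h y"
  shows "paraconvex_on C f \<nu> \<rho> \<longleftrightarrow> paraconvex_on C h \<nu> \<rho>"
proof -
  have "t *\<^sub>R x + (1 - t) *\<^sub>R y \<in> C" if "x \<in> C" "y \<in> C" "t \<in> {0..1}" for x y t
    using that assms(1) by (auto simp: convex_def)
  then show ?thesis
    unfolding paraconvex_on_def by (intro ball_cong refl) (simp add: assms(2))
qed

text \<open>
  Adding one vertex to a polytope raises the bound at most by the paraconvexity error over its
  diameter; for convex functions the maximum over the vertices would persist.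
\<close>

lemma paraconvex_bounded_above_on_hull:
  fixes g :: "'a::euclidean_space \<Rightarrow> real"
  assumes pc: "paraconvex_on C (\<lambda>y. ereal (g y)) \<nu> \<rho>" and "convex C"
    and "0 \<le> \<rho>" "0 \<le> \<nu>" and "finite S" "S \<subseteq> C"
  shows "\<exists>B. \<forall>y\<in>convex hull S. g y \<le> B"
  using \<open>finite S\<close> \<open>S \<subseteq> C\<close>
proof (induction S rule: finite_induct)
  case empty
  then show ?case by simp
next
  case (insert a S)
  then obtain B where B: "\<And>y. y \<in> convex hull S \<Longrightarrow> g y \<le> B" by auto
  have hull: "convex hull S \<subseteq> C"
    using insert.prems \<open>convex C\<close> by (simp add: hull_minimal)
  show ?case
  proof (cases "S = {}")
    case True
    then show ?thesis by auto
  next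
    case False
    have "bounded (convex hull S)"
      using insert.hyps by (simp add: bounded_convex_hull finite_imp_bounded)
    then obtain R where R: "\<And>y. y \<in> convex hull S \<Longrightarrow> norm (a - y) \<le> R"
      by (metis bounded_any_center dist_norm)
    have "g y \<le> max (g a) B + \<rho> * R powr (1 + \<nu>)" if y: "y \<in> convex hull (insert a S)" for y
    proof -
      obtain u v b where uv: "0 \<le> u" "0 \<le> v" "u + v = 1" "b \<in> convex hull S"
        and y_eq: "y = u *\<^sub>R a + v *\<^sub>R b"
        using y unfolding convex_hull_insert[OF False] by auto
      have v: "v = 1 - u" using uv by simp
      have "g y \<le> u * g a + (1 - u) * g b + \<rho> * min u (1 - u) * norm (a - b) powr (1 + \<nu>)"
        using paraconvex_onD[OF pc] uv insert.prems hull unfolding y_eq v by auto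
      also have "u * g a + (1 - u) * g b \<le> max (g a) B"
        using uv B[OF uv(4)] v by (intro convex_bound_le) auto
      also have "\<rho> * min u (1 - u) * norm (a - b) powr (1 + \<nu>) \<le> \<rho> * 1 * R powr (1 + \<nu>)"
        using uv R[OF uv(4)] \<open>0 \<le> \<rho>\<close> \<open>0 \<le> \<nu>\<close> by (intro mult_mono powr_mono2) auto
      finally show ?thesis by simp
    qed
    then show ?thesis by blast
  qed
qed

text \<open>
  As for convex functions, an upper bound B on a neighbourhood of x forces continuity at x.  Write y
  as a point between x and a point x + h at fixed distance e, which bounds g y - g x from above;
  write x as a point between y and x - h, which bounds it from below.  In both cases the weight of
  the far point, and with it the paraconvexity error, is at most norm (y - x) / e.
\<close>

lemma paraconvex_imp_continuous_on:
  fixes g :: "'a::euclidean_space \<Rightarrow> real"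
  assumes pc: "paraconvex_on C (\<lambda>y. ereal (g y)) \<nu> \<rho>" and "open C" "convex C"
    and "0 \<le> \<rho>" "0 \<le> \<nu>"
  shows "continuous_on C g"
  unfolding continuous_on_eq_continuous_at[OF \<open>open C\<close>]
proof
  fix x assume x: "x \<in> C"
  obtain a b where ab: "x \<in> box a b" "cbox a b \<subseteq> C"
    using open_contains_cbox \<open>open C\<close> x by metis
  obtain S where S: "finite S" "cbox a b = convex hull S"
    using closed_interval_as_convex_hull by metis
  have "S \<subseteq> C"
    using S(2) ab(2) hull_subset by fastforce
  obtain B where B: "\<And>y. y \<in> cbox a b \<Longrightarrow> g y \<le> B"
    using paraconvex_bounded_above_on_hull[OF pc \<open>convex C\<close> \<open>0 \<le> \<rho>\<close> \<open>0 \<le> \<nu>\<close> S(1) \<open>S \<subseteq> C\<close>]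
    unfolding S(2)[symmetric] by blast
  obtain e where e: "e > 0" "cball x e \<subseteq> box a b"
    using open_contains_cball open_box ab(1) by metis
  have sub: "cball x e \<subseteq> cbox a b"
    using e(2) box_subset_cbox by blast
  (* 2 * e bounds the lengths of both segments *)
  define K where "K = \<bar>B - g x\<bar> + \<rho> * (2 * e) powr (1 + \<nu>)"
  have bound: "\<bar>g y - g x\<bar> \<le> norm (y - x) / e * K" if y: "y \<in> ball x e" for y
  proof (cases "y = x")
    case False
    define t where "t = norm (y - x) / e"
    have t: "0 < t" "t < 1"
      using e False y by (auto simp: t_def dist_norm norm_minus_commute)
    define h where "h = (1 / t) *\<^sub>R (y - x)"
    have nh: "norm h = e"
      using e False by (simp add: h_def t_def)
    have th: "t *\<^sub>R h = y - x"
      using t by (simp add: h_def)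
    have in_box: "x + h \<in> cball x e" "x - h \<in> cball x e" "y \<in> cball x e"
      using nh y by (auto simp: dist_norm)
    have in_C: "x + h \<in> C" "x - h \<in> C" "y \<in> C"
      using in_box sub ab(2) by blast+
    have "g (t *\<^sub>R (x + h) + (1 - t) *\<^sub>R x)
        \<le> t * g (x + h) + (1 - t) * g x + \<rho> * min t (1 - t) * norm (x + h - x) powr (1 + \<nu>)"
      using paraconvex_onD[OF pc in_C(1) x] t by simp
    moreover have "t *\<^sub>R (x + h) + (1 - t) *\<^sub>R x = y"
      using th by (simp add: algebra_simps)
    moreover have "\<rho> * min t (1 - t) * norm (x + h - x) powr (1 + \<nu>) \<le> \<rho> * t * (2 * e) powr (1 + \<nu>)"
      using e nh t \<open>0 \<le> \<rho>\<close> \<open>0 \<le> \<nu>\<close> by (intro mult_mono powr_mono2) auto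
    moreover have "t * g (x + h) \<le> t * B"
      using B[OF subsetD[OF sub in_box(1)]] t by (intro mult_left_mono) auto
    ultimately have "g y - g x \<le> t * (B - g x) + t * (\<rho> * (2 * e) powr (1 + \<nu>))"
      by (simp add: algebra_simps)
    also have "\<dots> \<le> t * K"
      using t unfolding K_def distrib_left[symmetric] by (intro mult_left_mono) auto
    finally have upper: "g y - g x \<le> t * K" .
    (* x is the point of the segment from x - h to y that divides it in the ratio 1 : t *)
    define s where "s = t / (1 + t)"
    have s: "0 < s" "s < 1" "(1 + t) * s = t" "(1 + t) * (1 - s) = 1"
      using t by (auto simp: s_def field_simps)
    have "g (s *\<^sub>R (x - h) + (1 - s) *\<^sub>R y)
        \<le> s * g (x - h) + (1 - s) * g y + \<rho> * min s (1 - s) * norm (x - h - y) powr (1 + \<nu>)"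
      using paraconvex_onD[OF pc in_C(2,3)] s by simp
    moreover have "s *\<^sub>R (x - h) + (1 - s) *\<^sub>R y = x"
    proof -
      have "y = x + t *\<^sub>R h" using th by simp
      then have "s *\<^sub>R (x - h) + (1 - s) *\<^sub>R y = x + ((1 - s) * t - s) *\<^sub>R h"
        by (simp add: algebra_simps)
      moreover have "(1 - s) * t - s = 0"
        using s(3) by (simp add: algebra_simps)
      ultimately show ?thesis by simp
    qed
    moreover have "\<rho> * min s (1 - s) * norm (x - h - y) powr (1 + \<nu>) \<le> \<rho> * s * (2 * e) powr (1 + \<nu>)"
    proof -
      have "norm (x - h - y) \<le> norm (x - y) + norm h"
        using norm_triangle_ineq4[of "x - y" h] by (simp add: algebra_simps)
      also have "\<dots> \<le> 2 * e"
        using nh y by (simp add: dist_norm)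
      finally show ?thesis
        using e s \<open>0 \<le> \<rho>\<close> \<open>0 \<le> \<nu>\<close> by (intro mult_mono powr_mono2) auto
    qed
    moreover have "s * g (x - h) \<le> s * B"
      using B[OF subsetD[OF sub in_box(2)]] s by (intro mult_left_mono) auto
    ultimately have "g x \<le> s * B + (1 - s) * g y + s * (\<rho> * (2 * e) powr (1 + \<nu>))"
      by (simp add: algebra_simps)
    then have "(1 + t) * g x \<le> (1 + t) * (s * B + (1 - s) * g y + s * (\<rho> * (2 * e) powr (1 + \<nu>)))"
      using t by (intro mult_left_mono) auto
    also have "\<dots> = ((1 + t) * s) * B + ((1 + t) * (1 - s)) * g y + ((1 + t) * s) * (\<rho> * (2 * e) powr (1 + \<nu>))"
      by (simp only: distrib_left mult.assoc)
    finally have "g x - g y \<le> t * (B - g x) + t * (\<rho> * (2 * e) powr (1 + \<nu>))"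
      unfolding s by (simp add: algebra_simps)
    also have "\<dots> \<le> t * K"
      using t unfolding K_def distrib_left[symmetric] by (intro mult_left_mono) auto
    finally show ?thesis
      using upper unfolding t_def by linarith
  qed simp
  have "((\<lambda>y. g y - g x) \<longlongrightarrow> 0) (at x)"
  proof (rule Lim_null_comparison)
    show "\<forall>\<^sub>F y in at x. norm (g y - g x) \<le> norm (y - x) / e * K"
      using bound e by (auto simp: eventually_at dist_commute intro!: exI[of _ e])
    show "((\<lambda>y. norm (y - x) / e * K) \<longlongrightarrow> 0) (at x)"
      by (rule tendsto_eq_intros refl | use e in simp)+
  qed
  then show "isCont g x"
    using LIM_zero_cancel by (simp add: continuous_at)
qed

section \<open>Clarke subgradients of paraconvex functions\<close>

text \<open>
  The next facts are the changes of variables in Clarke difference quotients: the base point may be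
  moved along the direction in step with t, and t may be rescaled.  They are the reason why Clarke's
  directional derivative is subadditive and positively homogeneous.
\<close>

lemma filterlim_shifted_base_point:
  fixes v :: "'a::real_normed_vector"
  shows "filterlim (\<lambda>p. fst p + snd p *\<^sub>R v) (nhds x) (nhds x \<times>\<^sub>F at_right (0::real))"
proof -
  have "(snd \<longlongrightarrow> 0) (nhds x \<times>\<^sub>F at_right (0::real))"
    using filterlim_snd[of "at_right (0::real)" "nhds x"] by (simp add: filterlim_at)
  then have "((\<lambda>p. fst p + snd p *\<^sub>R v) \<longlongrightarrow> x + 0 *\<^sub>R v) (nhds x \<times>\<^sub>F at_right (0::real))"
    by (intro tendsto_intros filterlim_fst)
  then show ?thesis by simp
qed

lemma eventually_at_right_snd: "\<forall>\<^sub>F p in F \<times>\<^sub>F at_right (0::real). 0 < snd p"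
  by (rule eventually_compose_filterlim[OF _ filterlim_snd]) (simp add: eventually_at_right_less)

lemma filterlim_rescaled_step:
  assumes "0 < c"
  shows "filterlim (\<lambda>p. (fst p, c * snd p)) (F \<times>\<^sub>F at_right (0::real)) (F \<times>\<^sub>F at_right 0)"
proof (intro filterlim_Pair filterlim_fst)
  have "(snd \<longlongrightarrow> 0) (F \<times>\<^sub>F at_right (0::real))"
    using filterlim_snd[of "at_right (0::real)" F] by (simp add: filterlim_at)
  then have "((\<lambda>p. c * snd p) \<longlongrightarrow> c * 0) (F \<times>\<^sub>F at_right (0::real))"
    by (intro tendsto_intros)
  moreover have "\<forall>\<^sub>F p in F \<times>\<^sub>F at_right (0::real). 0 < c * snd p"
    using eventually_at_right_snd by eventually_elim (simp add: assms)
  ultimately show "filterlim (\<lambda>p. c * snd p) (at_right 0) (F \<times>\<^sub>F at_right (0::real))"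
    by (auto simp: filterlim_at elim: eventually_mono)
qed

text \<open>
  The Clarke subdifferential is a local notion, so an extended real-valued function may be replaced
  by a real-valued one on the open set where it is finite.
\<close>

lemma clarke_subdiff_cong:
  assumes "\<forall>\<^sub>F y in nhds x. f y = h y"
  shows "clarke_subdiff f x = clarke_subdiff h x"
proof -
  have "clarke_dir_deriv f x v = clarke_dir_deriv h x v" for v
    unfolding clarke_dir_deriv_def
  proof (rule Limsup_eq)
    have "\<forall>\<^sub>F p in nhds x \<times>\<^sub>F at_right (0::real). f (fst p) = h (fst p)"
      using eventually_compose_filterlim[OF assms filterlim_fst] .
    moreover have "\<forall>\<^sub>F p in nhds x \<times>\<^sub>F at_right (0::real).
        f (fst p + snd p *\<^sub>R v) = h (fst p + snd p *\<^sub>R v)"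
      using eventually_compose_filterlim[OF assms filterlim_shifted_base_point] .
    ultimately show "\<forall>\<^sub>F p in nhds x \<times>\<^sub>F at_right (0::real).
        (case p of (y, t) \<Rightarrow> (f (y + t *\<^sub>R v) - f y) / ereal t)
        = (case p of (y, t) \<Rightarrow> (h (y + t *\<^sub>R v) - h y) / ereal t)"
      by eventually_elim auto
  qed
  then show ?thesis by (simp add: clarke_subdiff_def)
qed

lemma clarke_dir_deriv_le:
  assumes "\<forall>\<^sub>F p in nhds x \<times>\<^sub>F at_right (0::real). g (fst p + snd p *\<^sub>R v) - g (fst p) \<le> snd p * r"
  shows "clarke_dir_deriv (\<lambda>y. ereal (g y)) x v \<le> ereal r"
  unfolding clarke_dir_deriv_def
proof (rule Limsup_bounded)
  show "\<forall>\<^sub>F p in nhds x \<times>\<^sub>F at_right 0.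
       (case p of (y, t) \<Rightarrow> (ereal (g (y + t *\<^sub>R v)) - ereal (g y)) / ereal t) \<le> ereal r"
    using assms eventually_at_right_snd
    by eventually_elim (auto simp: field_simps)
qed

lemma clarke_dir_deriv_lessD:
  assumes "clarke_dir_deriv (\<lambda>y. ereal (g y)) x v < ereal r"
  shows "\<forall>\<^sub>F p in nhds x \<times>\<^sub>F at_right (0::real). g (fst p + snd p *\<^sub>R v) - g (fst p) \<le> snd p * r"
  using Limsup_lessD[OF assms[unfolded clarke_dir_deriv_def]] eventually_at_right_snd
  by eventually_elim (auto simp: field_simps)

text \<open>
  On the segment from y to y + v paraconvexity bounds the difference quotient by
  g (y + v) - g y plus the error term, uniformly in the step t.  Continuity at x and at x + v then
  turns this into a bound for all base points y near x.
\<close>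

lemma paraconvex_quotient_bound:
  fixes g :: "'a::euclidean_space \<Rightarrow> real"
  assumes pc: "paraconvex_on C (\<lambda>y. ereal (g y)) \<nu> \<rho>" and "open C" "convex C"
    and "0 \<le> \<rho>" "0 \<le> \<nu>" and x: "x \<in> C" and xv: "x + v \<in> C"
    and r: "g (x + v) - g x + \<rho> * norm v powr (1 + \<nu>) < r"
  shows "\<forall>\<^sub>F p in nhds x \<times>\<^sub>F at_right (0::real). g (fst p + snd p *\<^sub>R v) - g (fst p) \<le> snd p * r"
proof -
  have cont: "continuous_on C g"
    by (rule paraconvex_imp_continuous_on[OF pc]) fact+
  have gx: "(g \<longlongrightarrow> g x) (nhds x)" "(g \<longlongrightarrow> g (x + v)) (nhds (x + v))"
    using cont x xv \<open>open C\<close> by (auto simp: continuous_on_eq_continuous_at tendsto_nhds_iff isCont_def)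
  have shift: "filterlim (\<lambda>y. y + v) (nhds (x + v)) (nhds x)"
    by (intro tendsto_intros) (simp add: filterlim_ident)
  have "((\<lambda>y. g (y + v) - g y + \<rho> * norm v powr (1 + \<nu>))
      \<longlongrightarrow> g (x + v) - g x + \<rho> * norm v powr (1 + \<nu>)) (nhds x)"
    by (intro tendsto_intros gx filterlim_compose[OF gx(2) shift])
  from order_tendstoD(2)[OF this r]
  have "\<forall>\<^sub>F y in nhds x. g (y + v) - g y + \<rho> * norm v powr (1 + \<nu>) < r" .
  moreover have "\<forall>\<^sub>F y in nhds x. y \<in> C" "\<forall>\<^sub>F y in nhds x. y + v \<in> C"
    using x xv \<open>open C\<close> eventually_compose_filterlim[OF _ shift, of "\<lambda>y. y \<in> C"]
    by (auto simp: eventually_nhds_in_open)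
  ultimately have "\<forall>\<^sub>F y in nhds x. y \<in> C \<and> y + v \<in> C \<and> g (y + v) - g y + \<rho> * norm v powr (1 + \<nu>) < r"
    by eventually_elim auto
  then have "\<forall>\<^sub>F p in nhds x \<times>\<^sub>F at_right (0::real). fst p \<in> C \<and> fst p + v \<in> C \<and>
      g (fst p + v) - g (fst p) + \<rho> * norm v powr (1 + \<nu>) < r"
    by (rule eventually_compose_filterlim[OF _ filterlim_fst])
  moreover have "\<forall>\<^sub>F p in nhds x \<times>\<^sub>F at_right (0::real). snd p < 1"
    by (rule eventually_compose_filterlim[OF _ filterlim_snd])
      (auto simp: eventually_at_right[of 0 1] intro!: exI[of _ 1])
  ultimately show ?thesis
    using eventually_at_right_snd
  proof eventually_elim
    case (elim p)
    define y t where "y = fst p" and "t = snd p"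
    have y: "y \<in> C" "y + v \<in> C" "g (y + v) - g y + \<rho> * norm v powr (1 + \<nu>) < r" and t: "0 < t" "t < 1"
      using elim by (auto simp: y_def t_def)
    have "g (t *\<^sub>R (y + v) + (1 - t) *\<^sub>R y)
        \<le> t * g (y + v) + (1 - t) * g y + \<rho> * min t (1 - t) * norm (y + v - y) powr (1 + \<nu>)"
      using paraconvex_onD[OF pc y(2,1)] t by simp
    also have "t *\<^sub>R (y + v) + (1 - t) *\<^sub>R y = y + t *\<^sub>R v"
      by (simp add: algebra_simps)
    also have "\<rho> * min t (1 - t) * norm (y + v - y) powr (1 + \<nu>) \<le> \<rho> * t * norm v powr (1 + \<nu>)"
      using t \<open>0 \<le> \<rho>\<close> by (intro mult_mono) auto
    finally have "g (y + t *\<^sub>R v) - g y \<le> t * (g (y + v) - g y + \<rho> * norm v powr (1 + \<nu>))"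
      by (simp add: algebra_simps)
    also have "\<dots> \<le> t * r"
      using y t by (intro mult_left_mono) auto
    finally show ?case
      by (simp add: y_def t_def)
  qed
qed

text \<open>
  The substitute for the subgradient inequality of convex analysis: a Clarke subgradient supports
  the function on all of C, up to an error of order 1 + \<nu>.
\<close>

lemma paraconvex_subgradient_ineq:
  fixes g :: "'a::euclidean_space \<Rightarrow> real"
  assumes pc: "paraconvex_on C (\<lambda>y. ereal (g y)) \<nu> \<rho>" and "open C" "convex C"
    and "0 \<le> \<rho>" "0 \<le> \<nu>" and "x \<in> C" "z \<in> C"
    and w: "w \<in> clarke_subdiff (\<lambda>y. ereal (g y)) x"
  shows "w \<bullet> (z - x) \<le> g z - g x + \<rho> * norm (z - x) powr (1 + \<nu>)"
proof (rule dense_ge)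
  fix r assume "g z - g x + \<rho> * norm (z - x) powr (1 + \<nu>) < r"
  then have "clarke_dir_deriv (\<lambda>y. ereal (g y)) x (z - x) \<le> ereal r"
    using assms by (intro clarke_dir_deriv_le paraconvex_quotient_bound[OF pc]) auto
  moreover have "ereal (w \<bullet> (z - x)) \<le> clarke_dir_deriv (\<lambda>y. ereal (g y)) x (z - x)"
    using w by (auto simp: clarke_subdiff_def)
  ultimately show "w \<bullet> (z - x) \<le> r"
    using ereal_less_eq(3) order_trans by blast
qed

text \<open>
  This is the Hahn-Banach argument.  The pairs (v, r) such that the difference quotients in
  direction v are eventually at most r form a convex cone E, essentially the epigraph of Clarke's
  directional derivative.  The cone misses the open half-line N below the origin.  A separating
  hyperplane cannot be vertical, because each direction v occurs in E with some r, and its slope is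
  a subgradient.
\<close>

lemma clarke_subdiff_nonempty:
  fixes g :: "'a::euclidean_space \<Rightarrow> real"
  assumes fin: "\<And>v. \<exists>r. clarke_dir_deriv (\<lambda>y. ereal (g y)) x v < ereal r"
  shows "clarke_subdiff (\<lambda>y. ereal (g y)) x \<noteq> {}"
proof -
  let ?F = "nhds x \<times>\<^sub>F at_right (0::real)"
  define E where "E = {(v, r). \<forall>\<^sub>F p in ?F. g (fst p + snd p *\<^sub>R v) - g (fst p) \<le> snd p * r}"
  have scale: "(c *\<^sub>R v, c * r) \<in> E" if "(v, r) \<in> E" "0 \<le> c" for c v r
  proof (cases "c = 0")
    case False
    then have "0 < c" using that by simp
    from that(1) have "\<forall>\<^sub>F p in ?F. g (fst p + snd p *\<^sub>R v) - g (fst p) \<le> snd p * r"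
      by (simp add: E_def)
    from eventually_compose_filterlim[OF this filterlim_rescaled_step[OF \<open>0 < c\<close>]]
    show ?thesis by (simp add: E_def mult_ac)
  qed (simp add: E_def)
  have add: "(v + w, r + s) \<in> E" if "(v, r) \<in> E" "(w, s) \<in> E" for v w r s
  proof -
    have lim: "filterlim (\<lambda>p. (fst p + snd p *\<^sub>R v, snd p)) ?F ?F"
      by (intro filterlim_Pair filterlim_shifted_base_point filterlim_snd)
    have "\<forall>\<^sub>F p in ?F. g (fst p + snd p *\<^sub>R v) - g (fst p) \<le> snd p * r"
      using that(1) by (simp add: E_def)
    moreover have "\<forall>\<^sub>F p in ?F. g (fst p + snd p *\<^sub>R w) - g (fst p) \<le> snd p * s"
      using that(2) by (simp add: E_def)
    note eventually_compose_filterlim[OF this lim]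
    ultimately have "\<forall>\<^sub>F p in ?F. g (fst p + snd p *\<^sub>R (v + w)) - g (fst p) \<le> snd p * (r + s)"
      by eventually_elim (simp add: algebra_simps)
    then show ?thesis by (simp add: E_def)
  qed
  have "convex E"
  proof (rule convexI)
    fix p q :: "'a \<times> real" and u v :: real
    assume "p \<in> E" "q \<in> E" "0 \<le> u" "0 \<le> v" "u + v = 1"
    then show "u *\<^sub>R p + v *\<^sub>R q \<in> E"
      using add[OF scale scale, of "fst p" "snd p" u "fst q" "snd q" v]
      by (simp add: scaleR_prod_def plus_prod_def)
  qed
  define N :: "('a \<times> real) set" where "N = {0} \<times> {..<0}"
  have pos: "0 \<le> r" if "(0, r) \<in> E" for r
  proof -
    have "\<forall>\<^sub>F p in ?F. 0 \<le> snd p * r" using that by (simp add: E_def)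
    then have "\<forall>\<^sub>F p in ?F. 0 \<le> r"
      using eventually_at_right_snd by eventually_elim (simp add: zero_le_mult_iff)
    moreover have "?F \<noteq> bot" by (simp add: prod_filter_eq_bot)
    ultimately show ?thesis by (simp add: eventually_const)
  qed
  have "E \<inter> N = {}"
    using pos by (force simp: N_def)
  moreover have "(0, 0) \<in> E" by (simp add: E_def)
  moreover have "(0, -1) \<in> N" by (simp add: N_def)
  moreover have "convex N" by (auto simp: N_def intro: convex_Times)
  ultimately obtain ab c where ab: "ab \<noteq> 0" "\<And>p. p \<in> N \<Longrightarrow> ab \<bullet> p \<le> c" "\<And>p. p \<in> E \<Longrightarrow> c \<le> ab \<bullet> p"
    using separating_hyperplane_sets[of N E] \<open>convex E\<close> by blast
  obtain a b where ab_eq: "ab = (a, b)" by (cases ab)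
  have "c \<le> 0"
    using ab(3)[OF \<open>(0, 0) \<in> E\<close>] by (simp add: ab_eq)
  have b_le: "b * (- s) \<le> c" if "0 < s" for s
    using ab(2)[of "(0, - s)"] that by (simp add: ab_eq N_def)
  have "0 \<le> b"
    using b_le[of 1] \<open>c \<le> 0\<close> by simp
  have E_nonneg: "0 \<le> a \<bullet> v + b * r" if "(v, r) \<in> E" for v r
  proof (rule ccontr)
    assume neg: "\<not> ?thesis"
    (* stretching the element of the cone makes its value arbitrarily negative *)
    define t where "t = (c - 1) / (a \<bullet> v + b * r)"
    have "0 \<le> t" using neg \<open>c \<le> 0\<close> by (simp add: t_def divide_nonpos_neg)
    then have "c \<le> t * (a \<bullet> v + b * r)"
      using ab(3)[OF scale[OF that, of t]] by (simp add: ab_eq algebra_simps)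
    also have "\<dots> = c - 1" using neg by (simp add: t_def)
    finally show False by simp
  qed
  (* a vertical hyperplane is refuted by the direction - a *)
  have "b \<noteq> 0"
  proof
    assume "b = 0"
    obtain r where "clarke_dir_deriv (\<lambda>y. ereal (g y)) x (- a) < ereal r"
      using fin by blast
    then have "(- a, r) \<in> E" using clarke_dir_deriv_lessD[of g x "- a" r] by (simp add: E_def)
    from E_nonneg[OF this] \<open>b = 0\<close> have "a = 0"
      by (metis add.right_neutral inner_gt_zero_iff inner_minus_right mult_zero_left
          neg_0_le_iff_le not_less)
    with \<open>b = 0\<close> ab(1) show False by (simp add: ab_eq zero_prod_def)
  qed
  with \<open>0 \<le> b\<close> have "0 < b" by simp
  define w where "w = - (1 / b) *\<^sub>R a"
  have "ereal (w \<bullet> v) \<le> clarke_dir_deriv (\<lambda>y. ereal (g y)) x v" for v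
  proof (rule ccontr)
    assume "\<not> ?thesis"
    then obtain r where r: "clarke_dir_deriv (\<lambda>y. ereal (g y)) x v < ereal r" "ereal r < ereal (w \<bullet> v)"
      using ereal_dense2 by (metis not_le)
    then have "(v, r) \<in> E" by (simp add: E_def clarke_dir_deriv_lessD)
    from E_nonneg[OF this] have "w \<bullet> v \<le> r"
      using \<open>0 < b\<close> by (simp add: w_def field_simps)
    with r(2) show False by simp
  qed
  then show ?thesis by (auto simp: clarke_subdiff_def)
qed

text \<open>
  Clarke's directional derivative is bounded above by \<open>paraconvex_quotient_bound\<close> for short
  directions, whose endpoint stays in C, and hence for all directions by homogeneity.
\<close>

lemma paraconvex_clarke_subdiff_nonempty:
  fixes g :: "'a::euclidean_space \<Rightarrow> real"
  assumes pc: "paraconvex_on C (\<lambda>y. ereal (g y)) \<nu> \<rho>" and "open C" "convex C"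
    and "0 \<le> \<rho>" "0 \<le> \<nu>" and x: "x \<in> C"
  shows "clarke_subdiff (\<lambda>y. ereal (g y)) x \<noteq> {}"
proof (rule clarke_subdiff_nonempty)
  fix v :: 'a
  obtain e where e: "0 < e" "ball x e \<subseteq> C"
    using \<open>open C\<close> x open_contains_ball by metis
  define c where "c = e / (2 * (1 + norm v))"
  have pos: "0 < 1 + norm v" by (simp add: add_pos_nonneg)
  have c: "0 < c" using e pos by (simp add: c_def)
  have "norm (c *\<^sub>R v) = e * (norm v / (2 * (1 + norm v)))"
    using c e by (simp add: c_def)
  also have "norm v / (2 * (1 + norm v)) < 1"
  proof -
    have "norm v < 2 * (1 + norm v)" using pos by argo
    then show ?thesis using pos by (simp add: divide_less_eq)
  qed
  finally have "norm (c *\<^sub>R v) < e"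
    using e by simp
  then have xv: "x + c *\<^sub>R v \<in> C"
    using e by (auto simp: dist_norm)
  let ?F = "nhds x \<times>\<^sub>F at_right (0::real)"
  define r where "r = g (x + c *\<^sub>R v) - g x + \<rho> * norm (c *\<^sub>R v) powr (1 + \<nu>) + 1"
  have r: "\<forall>\<^sub>F p in ?F. g (fst p + snd p *\<^sub>R (c *\<^sub>R v)) - g (fst p) \<le> snd p * r"
    by (rule paraconvex_quotient_bound[OF pc \<open>open C\<close> \<open>convex C\<close> \<open>0 \<le> \<rho>\<close> \<open>0 \<le> \<nu>\<close> x xv])
      (simp add: r_def)
  from eventually_compose_filterlim[OF r filterlim_rescaled_step[of "inverse c"]]
  have "\<forall>\<^sub>F p in ?F. g (fst p + snd p *\<^sub>R v) - g (fst p) \<le> snd p * (r / c)"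
    using c by (simp add: field_simps)
  then have "clarke_dir_deriv (\<lambda>y. ereal (g y)) x v \<le> ereal (r / c)"
    by (rule clarke_dir_deriv_le)
  also have "\<dots> < ereal (r / c + 1)" by simp
  finally show "\<exists>r. clarke_dir_deriv (\<lambda>y. ereal (g y)) x v < ereal r" by blast
qed

section \<open>One step of the method\<close>

lemma closest_point_step:
  fixes w :: "'a::euclidean_space"
  assumes "closed X" "convex X" "p \<in> X"
  shows "(dist (closest_point X (x - a *\<^sub>R w)) p)\<^sup>2 \<le> (dist x p)\<^sup>2 - 2 * a * (w \<bullet> (x - p)) + a\<^sup>2 * (norm w)\<^sup>2"
proof -
  have "dist (closest_point X (x - a *\<^sub>R w)) (closest_point X p) \<le> dist (x - a *\<^sub>R w) p"
    using assms by (intro closest_point_lipschitz) auto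
  then have "(dist (closest_point X (x - a *\<^sub>R w)) p)\<^sup>2 \<le> (norm ((x - p) - a *\<^sub>R w))\<^sup>2"
    using assms by (simp add: closest_point_self dist_norm algebra_simps power_mono)
  also have "\<dots> = (norm (x - p))\<^sup>2 - 2 * a * (w \<bullet> (x - p)) + a\<^sup>2 * (norm w)\<^sup>2"
    unfolding power2_norm_eq_inner
    by (simp add: inner_diff_left inner_diff_right inner_commute power2_eq_square algebra_simps)
  finally show ?thesis by (simp add: dist_norm)
qed

text \<open>
  Let p be the minimizer closest to x and F = g x - m.  The subgradient inequality at p, whose error
  term is at most \<gamma> * F by the assumption on x, gives w \<bullet> (x - p) \<ge> (1 - \<gamma>) * F.  Insert this
  into the expansion of the squared distance to p; the Polyak step length makes the linear term
  and the quadratic term both multiples of F^2 / (norm w)^2, and the linear one prevails.  A vanishing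
  subgradient forces F = 0 by the same inequality.
\<close>

lemma scaled_Polyak_step_decrease:
  fixes g :: "'a::euclidean_space \<Rightarrow> real" and X M :: "'a set" and w x :: 'a
  assumes pc: "paraconvex_on C (\<lambda>y. ereal (g y)) \<nu> \<rho>" and C: "open C" "convex C"
    and \<rho>\<nu>: "0 \<le> \<rho>" "0 \<le> \<nu>"
    and X: "closed X" "convex X" "X \<subseteq> C" "x \<in> X"
    and M: "closed M" "M \<noteq> {}" "M \<subseteq> X" "\<And>p. p \<in> M \<Longrightarrow> g p = m"
    and F: "m \<le> g x"
    and near: "\<rho> * infdist x M powr (1 + \<nu>) \<le> \<gamma> * (g x - m)" and "\<gamma> < 1"
    and w: "w \<in> clarke_subdiff (\<lambda>y. ereal (g y)) x" "norm w \<le> L" and "0 < L"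
    and \<sigma>: "0 < \<sigma>" "0 \<le> 2 * \<sigma> * (1 - \<gamma>) - 1"
  defines "x' \<equiv> if w = 0 then x
     else closest_point X (x - ((g x - m) / (\<sigma> * norm w)) *\<^sub>R (w /\<^sub>R norm w))"
  shows "(infdist x' M)\<^sup>2 \<le> (infdist x M)\<^sup>2 - (2 * \<sigma> * (1 - \<gamma>) - 1) / (\<sigma> * L)\<^sup>2 * (g x - m)\<^sup>2"
proof -
  define F where "F = g x - m"
  define c where "c = 2 * \<sigma> * (1 - \<gamma>) - 1"
  have "0 \<le> F" "0 \<le> c" using assms by (auto simp: F_def c_def)
  obtain p where p: "p \<in> M" "infdist x M = dist x p"
    using infdist_attains_inf[OF M(1,2)] by metis
  have "p \<in> X" using p M by blast
  have "w \<bullet> (p - x) \<le> m - g x + \<rho> * infdist x M powr (1 + \<nu>)"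
    using paraconvex_subgradient_ineq[OF pc C \<rho>\<nu> _ _ w(1), of p] X \<open>p \<in> X\<close> M(4)[OF p(1)] p(2)
    by (auto simp: dist_norm norm_minus_commute)
  then have sub: "(1 - \<gamma>) * F \<le> w \<bullet> (x - p)"
    using near by (simp add: F_def inner_diff_right algebra_simps)
  show ?thesis
  proof (cases "w = 0")
    case True
    then have "F = 0"
      using sub \<open>0 \<le> F\<close> \<open>\<gamma> < 1\<close> by (simp add: mult_le_0_iff)
    then show ?thesis using True by (simp add: x'_def F_def)
  next
    case False
    define a where "a = F / (\<sigma> * (norm w)\<^sup>2)"
    have "0 \<le> a" using \<open>0 \<le> F\<close> \<sigma> by (simp add: a_def)
    have x': "x' = closest_point X (x - a *\<^sub>R w)"
      using False by (simp add: x'_def a_def F_def power2_eq_square divide_inverse mult_ac)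
    have "(infdist x' M)\<^sup>2 \<le> (dist x' p)\<^sup>2"
      using p(1) by (intro power_mono infdist_le infdist_nonneg)
    also have "\<dots> \<le> (dist x p)\<^sup>2 - 2 * a * (w \<bullet> (x - p)) + a\<^sup>2 * (norm w)\<^sup>2"
      unfolding x' by (rule closest_point_step) fact+
    also have "\<dots> \<le> (dist x p)\<^sup>2 - 2 * a * ((1 - \<gamma>) * F) + a\<^sup>2 * (norm w)\<^sup>2"
      using sub \<open>0 \<le> a\<close> by (simp add: mult_left_mono)
    also have "\<dots> = (dist x p)\<^sup>2 - c * F\<^sup>2 / (\<sigma> * norm w)\<^sup>2"
      using False \<sigma> by (simp add: a_def c_def power2_eq_square field_simps)
    also have "\<dots> \<le> (dist x p)\<^sup>2 - c * F\<^sup>2 / (\<sigma> * L)\<^sup>2"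
      using False \<sigma> \<open>0 \<le> c\<close> w(2) \<open>0 < L\<close>
      by (intro diff_left_mono divide_left_mono power_mono mult_left_mono) auto
    finally show ?thesis
      using p(2) by (simp add: F_def c_def)
  qed
qed

text \<open>
  The bound on d is the solution of \<rho> * d^(1 + \<nu>) = \<kappa> * d^(1 / \<delta>); since 1 + \<nu> > 1 / \<delta>, the
  paraconvexity error on the left is the smaller one below it.
\<close>

lemma growth_dominates_in_tube:
  fixes d :: real
  assumes "0 \<le> d" "d < (\<kappa> / \<rho>) powr (\<delta> / (\<delta> * (1 + \<nu>) - 1))"
    and "0 < \<rho>" "0 < \<kappa>" "0 < \<delta>" "1 < \<delta> * (1 + \<nu>)"
  shows "\<rho> * d powr (1 + \<nu>) \<le> \<kappa> * d powr (1 / \<delta>)"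
proof (cases "d = 0")
  case False
  define e where "e = (\<delta> * (1 + \<nu>) - 1) / \<delta>"
  have "0 < e" using assms by (simp add: e_def)
  have e: "1 + \<nu> = e + 1 / \<delta>" using assms by (simp add: e_def field_simps)
  have "d powr e \<le> ((\<kappa> / \<rho>) powr (\<delta> / (\<delta> * (1 + \<nu>) - 1))) powr e"
    using assms \<open>0 < e\<close> by (intro powr_mono2) auto
  also have "\<dots> = \<kappa> / \<rho>"
    using assms by (simp add: powr_powr e_def)
  finally have "\<rho> * d powr e \<le> \<kappa>"
    using assms by (simp add: field_simps)
  then have "\<rho> * d powr e * d powr (1 / \<delta>) \<le> \<kappa> * d powr (1 / \<delta>)"
    by (intro mult_right_mono) auto
  then show ?thesis unfolding e powr_add by (simp add: mult_ac)
qed simp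

section \<open>Scalar recursions\<close>

lemma sum_squares_of_decrease:
  fixes E F :: "nat \<Rightarrow> real"
  assumes "\<And>k. E (Suc k) \<le> E k - B * (F k)\<^sup>2" "\<And>k. 0 \<le> E k"
  shows "B * (\<Sum>i<k. (F i)\<^sup>2) \<le> E 0"
proof -
  have "E k + B * (\<Sum>i<k. (F i)\<^sup>2) \<le> E 0" for k
  proof (induction k)
    case (Suc k)
    then show ?case using assms(1)[of k] by (simp add: algebra_simps)
  qed simp
  then show ?thesis using assms(2)[of k] by (smt (verit))
qed

lemma tendsto_zero_of_decrease:
  fixes E F :: "nat \<Rightarrow> real"
  assumes "\<And>k. E (Suc k) \<le> E k - B * (F k)\<^sup>2" "\<And>k. 0 \<le> E k" "0 < B"
  shows "F \<longlonglongrightarrow> 0"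
proof -
  have "(\<Sum>i<k. (F i)\<^sup>2) \<le> E 0 / B" for k
    using sum_squares_of_decrease[of E B F k] assms by (simp add: field_simps)
  then have "summable (\<lambda>i. (F i)\<^sup>2)"
    by (intro summableI_nonneg_bounded[where x = "E 0 / B"]) auto
  then have "(\<lambda>i. (F i)\<^sup>2) \<longlonglongrightarrow> 0" by (rule summable_LIMSEQ_zero)
  then show ?thesis by (simp add: tendsto_null_power)
qed

lemma best_value_of_decrease:
  fixes E F :: "nat \<Rightarrow> real"
  assumes "\<And>k. E (Suc k) \<le> E k - B * (F k)\<^sup>2" "\<And>k. 0 \<le> E k" "0 < B"
  shows "\<exists>i\<le>k. F i \<le> sqrt (E 0 / (B * real (k + 1)))"
proof (rule ccontr)
  define b where "b = sqrt (E 0 / (B * real (k + 1)))"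
  have "0 \<le> b" using assms by (simp add: b_def)
  assume "\<not> ?thesis"
  then have "b < F i" if "i < Suc k" for i using that unfolding b_def by (meson less_Suc_eq_le not_le)
  then have "b\<^sup>2 < (F i)\<^sup>2" if "i < Suc k" for i
    using that \<open>0 \<le> b\<close> by (simp add: power_strict_mono)
  then have "(\<Sum>i<Suc k. b\<^sup>2) < (\<Sum>i<Suc k. (F i)\<^sup>2)"
    by (intro sum_strict_mono) auto
  then have "real (k + 1) * b\<^sup>2 < (\<Sum>i<Suc k. (F i)\<^sup>2)"
    by (simp add: algebra_simps)
  then have "B * (real (k + 1) * b\<^sup>2) < B * (\<Sum>i<Suc k. (F i)\<^sup>2)"
    using assms(3) by (rule mult_strict_left_mono)
  moreover have "B * (real (k + 1) * b\<^sup>2) = E 0"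
  proof -
    have "0 < B * real (k + 1)" using assms(3) by simp
    moreover have "b\<^sup>2 = E 0 / (B * real (k + 1))"
      unfolding b_def using assms(2,3) by (intro real_sqrt_pow2) simp
    ultimately show ?thesis using assms(3) by simp
  qed
  ultimately show False
    using sum_squares_of_decrease[of E B F "Suc k", OF assms(1,2)] by (metis not_le)
qed

text \<open>
  The discrete analogue of the differential equation s' = - A s^(1 + q): the quantity s^(- q) grows
  by at least q * A per step, by Bernoulli's inequality for negative exponents.
\<close>

lemma superlinear_recursion_decay:
  fixes s :: "nat \<Rightarrow> real"
  assumes nonneg: "\<And>k. 0 \<le> s k" and rec: "\<And>k. s (Suc k) \<le> (1 - A * s k powr q) * s k"
    and "0 < A" "0 < q" and "0 < k"
  shows "s k \<le> (q * A) powr (- (1 / q)) * real k powr (- (1 / q))"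
proof (cases "s k = 0")
  case False
  have grow: "q * A * real j \<le> s j powr (- q)" if "s j \<noteq> 0" for j
    using that
  proof (induction j)
    case (Suc j)
    have "s j \<noteq> 0"
      using rec[of j] Suc.prems nonneg[of "Suc j"] by auto
    then have pos: "0 < s j" "0 < s (Suc j)"
      using nonneg[of j] nonneg[of "Suc j"] Suc.prems by auto
    define u where "u = A * s j powr q"
    have "0 < (1 - u) * s j"
      using rec[of j] pos by (simp add: u_def)
    then have u: "u < 1" using pos by (simp add: zero_less_mult_iff)
    have "1 + q * u \<le> exp (q * u)" by (rule exp_ge_add_one_self)
    also have "\<dots> \<le> exp (- q * ln (1 - u))"
      using mult_left_mono[of "ln (1 - u)" "- u" q] ln_le_minus_one[of "1 - u"] u \<open>0 < q\<close> by simp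
    also have "\<dots> = (1 - u) powr (- q)"
      using u by (simp add: powr_def)
    finally have bernoulli: "1 + q * u \<le> (1 - u) powr (- q)" .
    have "q * A * real (Suc j) \<le> s j powr (- q) + q * A"
      using Suc.IH[OF \<open>s j \<noteq> 0\<close>] by (simp add: algebra_simps)
    also have "\<dots> = (1 + q * u) * s j powr (- q)"
      using pos by (simp add: u_def algebra_simps powr_minus)
    also have "\<dots> \<le> (1 - u) powr (- q) * s j powr (- q)"
      by (intro mult_right_mono bernoulli) simp
    also have "\<dots> = ((1 - u) * s j) powr (- q)"
      using u pos by (simp add: powr_mult)
    also have "\<dots> \<le> s (Suc j) powr (- q)"
      using rec[of j] pos u \<open>0 < q\<close> by (intro powr_mono2') (auto simp: u_def)
    finally show ?case .
  qed simp
  have "0 < s k" using False nonneg[of k] by simp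
  then have "s k = (s k powr (- q)) powr (- (1 / q))"
    using \<open>0 < q\<close> by (simp add: powr_powr)
  also have "\<dots> \<le> (q * A * real k) powr (- (1 / q))"
    using grow[OF False] assms by (intro powr_mono2') auto
  also have "\<dots> = (q * A) powr (- (1 / q)) * real k powr (- (1 / q))"
    using assms by (simp add: powr_mult)
  finally show ?thesis .
qed simp

section \<open>Convergence of the projected subgradient method\<close>

(* The guard on the Q-linear rate only excludes the case that all points of X are minimizers and
   the radicand is negative (X a singleton with a large error bound constant, say): then all
   distances vanish, but there is no real rate of the given form.  If X contains a
   non-minimizer, nonnegativity of the radicand is part of the claim. *)
theorem theorem4p11:
  fixes f :: "real ^ 'n \<Rightarrow> ereal"
    and X X' :: "(real ^ 'n) set"
    and fstar \<rho> \<nu> \<delta> \<mu> L \<tau> \<sigma> \<gamma> :: real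
    and x \<zeta> :: "nat \<Rightarrow> real ^ 'n"
    and \<alpha> :: "nat \<Rightarrow> real"
  assumes "proper_fun f"
    and "X \<subseteq> effective_domain f" "X \<noteq> {}" "closed X" "convex X"
    and "minimizers f X \<noteq> {}"
    and "ereal fstar = (INF y\<in>X. f y)"
    and "\<rho> > 0" "0 < \<nu>" "\<nu> \<le> 1" "1 / (1 + \<nu>) < \<delta>" "\<delta> \<le> 1" "\<mu> > 0"
    and "open X'" "convex X'" "X \<subseteq> X'" "X' \<subseteq> effective_domain f"
    and paraconvex: "paraconvex_on X' f \<nu> \<rho>"
    and error_bound:
      "\<And>y. y \<in> X \<Longrightarrow> ereal (\<mu> * infdist y (minimizers f X) powr (1 / \<delta>)) \<le> f y - ereal fstar"
    and "ereal L = Sup {ereal (norm w) | w y. y \<in> tube f X \<mu> \<rho> \<nu> \<delta> 1 \<and> w \<in> clarke_subdiff f y}"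
    and "0 < L"
    and "\<tau> = \<mu> / L"
    and "\<sigma> > 1 / 2" "0 < \<gamma>" "\<gamma> < (2 * \<sigma> - 1) / (2 * \<sigma>)"
    and "projected_subgradient f X \<alpha> x \<zeta>"
    and "x 0 \<in> tube f X \<mu> \<rho> \<nu> \<delta> \<gamma>"
    and scaled_Polyak:
      "\<And>k. \<zeta> k \<noteq> 0 \<Longrightarrow> \<alpha> k = (real_of_ereal (f (x k)) - fstar) / (\<sigma> * norm (\<zeta> k))"
  shows
    "(\<forall>k. x k \<in> tube f X \<mu> \<rho> \<nu> \<delta> \<gamma> \<and>
          (infdist (x (Suc k)) (minimizers f X))\<^sup>2
            \<le> (1 - (2 * \<sigma> * (1 - \<gamma>) - 1) / \<sigma>\<^sup>2
                   * (\<tau> * infdist (x k) (minimizers f X) powr (1 / \<delta> - 1))\<^sup>2)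
               * (infdist (x k) (minimizers f X))\<^sup>2)
     \<and>
     (((\<exists>K. \<forall>k\<ge>K. infdist (x k) (minimizers f X) = 0) \<or>
       (decseq (\<lambda>k. infdist (x k) (minimizers f X)) \<and>
        (\<lambda>k. infdist (x k) (minimizers f X)) \<longlonglongrightarrow> 0)) \<and>
      (\<lambda>k. f (x k)) \<longlonglongrightarrow> ereal fstar)
     \<and>
     (\<delta> = 1 \<longrightarrow>
      minimizers f X \<noteq> X \<or> 0 \<le> 1 - (2 * \<sigma> * (1 - \<gamma>) - 1) / \<sigma>\<^sup>2 * \<tau>\<^sup>2 \<longrightarrow>
      Q_linear_to_zero (\<lambda>k. infdist (x k) (minimizers f X))
        (sqrt (1 - (2 * \<sigma> * (1 - \<gamma>) - 1) / \<sigma>\<^sup>2 * \<tau>\<^sup>2)))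
     \<and>
     (1 / (1 + \<nu>) < \<delta> \<and> \<delta> < 1 \<longrightarrow>
      (\<exists>\<eta>>0. \<forall>\<^sub>F k in sequentially.
         (infdist (x k) (minimizers f X))\<^sup>2 \<le> \<eta> * real k powr (- (\<delta> / (1 - \<delta>)))))
     \<and>
     (\<forall>k. Min ((\<lambda>i. f (x i)) ` {0..k}) - ereal fstar
            \<le> ereal (\<sigma> * L * infdist (x 0) (minimizers f X)
                      / (sqrt (2 * \<sigma> * (1 - \<gamma>) - 1) * sqrt (real (k + 1)))))"
proof -
  let ?M = "minimizers f X"
  define g where "g = (\<lambda>y. real_of_ereal (f y))"
  define c where "c = 2 * \<sigma> * (1 - \<gamma>) - 1"
  define A where "A = c / \<sigma>\<^sup>2 * \<tau>\<^sup>2"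
  define B where "B = c / (\<sigma> * L)\<^sup>2"
  have fg: "f y = ereal (g y)" if "y \<in> X'" for y
  proof -
    have "f y \<noteq> - \<infinity>" using \<open>proper_fun f\<close> by (simp add: proper_fun_def)
    moreover have "f y \<noteq> \<infinity>"
      using that \<open>X' \<subseteq> effective_domain f\<close> by (auto simp: effective_domain_def)
    ultimately show ?thesis by (cases "f y") (auto simp: g_def)
  qed
  have pc: "paraconvex_on X' (\<lambda>y. ereal (g y)) \<nu> \<rho>"
    using paraconvex_on_cong[OF \<open>convex X'\<close>, of f "\<lambda>y. ereal (g y)"] fg paraconvex by blast
  have subdiff: "clarke_subdiff f y = clarke_subdiff (\<lambda>y. ereal (g y)) y" if "y \<in> X'" for y
  proof (rule clarke_subdiff_cong)
    show "\<forall>\<^sub>F z in nhds y. f z = ereal (g z)"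
      using eventually_nhds_in_open[OF \<open>open X'\<close> that] by eventually_elim (rule fg)
  qed
  have cont: "continuous_on X g"
    using paraconvex_imp_continuous_on[OF pc \<open>open X'\<close> \<open>convex X'\<close>] \<open>\<rho> > 0\<close> \<open>0 < \<nu>\<close> \<open>X \<subseteq> X'\<close>
      continuous_on_subset by auto
  have \<delta>: "0 < \<delta>" "1 < \<delta> * (1 + \<nu>)"
  proof -
    have "0 < 1 / (1 + \<nu>)" using \<open>0 < \<nu>\<close> by simp
    then show "0 < \<delta>" using \<open>1 / (1 + \<nu>) < \<delta>\<close> by linarith
    show "1 < \<delta> * (1 + \<nu>)" using \<open>1 / (1 + \<nu>) < \<delta>\<close> \<open>0 < \<nu>\<close> by (simp add: field_simps)
  qed
  have \<gamma>1: "\<gamma> < 1"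
  proof -
    have "(2 * \<sigma> - 1) / (2 * \<sigma>) < 1" using \<open>\<sigma> > 1 / 2\<close> by simp
    then show ?thesis using \<open>\<gamma> < (2 * \<sigma> - 1) / (2 * \<sigma>)\<close> by linarith
  qed
  have c: "0 < c"
    using \<open>\<gamma> < (2 * \<sigma> - 1) / (2 * \<sigma>)\<close> \<open>\<sigma> > 1 / 2\<close> by (simp add: c_def field_simps)
  have \<tau>: "0 < \<tau>" using \<open>\<tau> = \<mu> / L\<close> \<open>\<mu> > 0\<close> \<open>0 < L\<close> by simp
  have A: "0 < A" and B: "0 < B"
    using c \<tau> \<open>0 < L\<close> \<open>\<sigma> > 1 / 2\<close> by (auto simp: A_def B_def)
  have fstar_le: "fstar \<le> g y" if "y \<in> X" for y
  proof -
    have "ereal fstar \<le> f y" unfolding \<open>ereal fstar = _\<close> using that by (rule INF_lower)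
    then show ?thesis using fg that \<open>X \<subseteq> X'\<close> by auto
  qed
  have M_eq: "?M = {y \<in> X. g y \<le> fstar}"
  proof -
    obtain p where p: "p \<in> X" "\<And>y. y \<in> X \<Longrightarrow> f p \<le> f y"
      using \<open>?M \<noteq> {}\<close> by (auto simp: minimizers_def is_arg_min_linorder)
    have "f p = ereal fstar"
      unfolding \<open>ereal fstar = _\<close> using p by (intro antisym INF_greatest INF_lower)
    then have "is_arg_min f (\<lambda>y. y \<in> X) y \<longleftrightarrow> y \<in> X \<and> f y \<le> ereal fstar" for y
      using p order_trans by (auto simp: is_arg_min_linorder)
    then show ?thesis using fg \<open>X \<subseteq> X'\<close> by (auto simp: minimizers_def)
  qed
  then have M: "?M \<subseteq> X" "\<And>p. p \<in> ?M \<Longrightarrow> g p = fstar"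
    using fstar_le by (auto intro: antisym)
  have "closed ?M"
    unfolding M_eq using continuous_on_closed_Collect_le[OF cont continuous_on_const \<open>closed X\<close>] .
  have eb: "\<mu> * infdist y ?M powr (1 / \<delta>) \<le> g y - fstar" if "y \<in> X" for y
    using error_bound[OF that] fg[of y] that \<open>X \<subseteq> X'\<close> by auto
  define T where "T = tube f X \<mu> \<rho> \<nu> \<delta> \<gamma>"
  have T_X: "y \<in> X" if "y \<in> T" for y
    using that by (simp add: T_def tube_def)
  have T_mono: "z \<in> T" if "y \<in> T" "z \<in> X" "infdist z ?M \<le> infdist y ?M" for y z
    using that by (simp add: T_def tube_def)
  have near: "\<rho> * infdist y ?M powr (1 + \<nu>) \<le> \<gamma> * (g y - fstar)" if "y \<in> T" for y
  proof -
    have "\<rho> * infdist y ?M powr (1 + \<nu>) \<le> \<gamma> * \<mu> * infdist y ?M powr (1 / \<delta>)"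
      using that \<delta> \<open>\<rho> > 0\<close> \<open>0 < \<gamma>\<close> \<open>\<mu> > 0\<close>
      by (intro growth_dominates_in_tube infdist_nonneg) (auto simp: T_def tube_def)
    also have "\<dots> \<le> \<gamma> * (g y - fstar)"
      using eb[OF T_X[OF that]] \<open>0 < \<gamma>\<close> by (simp add: mult.assoc)
    finally show ?thesis .
  qed
  have norm_le: "norm w \<le> L" if "y \<in> T" "w \<in> clarke_subdiff f y" for y w
  proof -
    have "(\<gamma> * \<mu> / \<rho>) powr (\<delta> / (\<delta> * (1 + \<nu>) - 1)) \<le> (1 * \<mu> / \<rho>) powr (\<delta> / (\<delta> * (1 + \<nu>) - 1))"
      using \<delta> \<gamma>1 \<open>\<rho> > 0\<close> \<open>0 < \<gamma>\<close> \<open>\<mu> > 0\<close>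
      by (intro powr_mono2 divide_right_mono mult_right_mono) auto
    then have "y \<in> tube f X \<mu> \<rho> \<nu> \<delta> 1"
      using that(1) by (simp add: T_def tube_def)
    then have "ereal (norm w) \<le> ereal L"
      unfolding \<open>ereal L = _\<close> using that(2) by (intro Sup_upper) blast
    then show ?thesis by simp
  qed
  (* The step map is considered at every point of the tube, and not only along the given sequence:
     the estimate of the linear rate uses it at an auxiliary point. *)
  define step where "step y w = (if w = 0 then y
     else closest_point X (y - ((g y - fstar) / (\<sigma> * norm w)) *\<^sub>R (w /\<^sub>R norm w)))" for y w
  have step: "(infdist (step y w) ?M)\<^sup>2 \<le> (infdist y ?M)\<^sup>2 - B * (g y - fstar)\<^sup>2"
    if "y \<in> T" "w \<in> clarke_subdiff f y" for y w
    unfolding step_def B_def c_def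
  proof (rule scaled_Polyak_step_decrease[OF pc \<open>open X'\<close> \<open>convex X'\<close>])
    show "w \<in> clarke_subdiff (\<lambda>y. ereal (g y)) y"
      using that T_X \<open>X \<subseteq> X'\<close> subdiff by blast
    show "0 \<le> 2 * \<sigma> * (1 - \<gamma>) - 1" using c by (simp add: c_def)
  qed (use that T_X M near \<open>closed X\<close> \<open>convex X\<close> norm_le fstar_le \<gamma>1 \<open>closed ?M\<close> \<open>?M \<noteq> {}\<close>
      \<open>X \<subseteq> X'\<close> \<open>\<rho> > 0\<close> \<open>0 < \<nu>\<close>
      \<open>0 < L\<close> \<open>\<sigma> > 1 / 2\<close> in auto)
  have contraction: "(infdist (step y w) ?M)\<^sup>2
      \<le> (1 - c / \<sigma>\<^sup>2 * (\<tau> * infdist y ?M powr (1 / \<delta> - 1))\<^sup>2) * (infdist y ?M)\<^sup>2"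
    if "y \<in> T" "w \<in> clarke_subdiff f y" for y w
  proof -
    let ?D = "infdist y ?M"
    have "?D powr (1 / \<delta> - 1) * ?D = ?D powr (1 / \<delta>)"
      using infdist_nonneg[of y ?M] by (cases "?D = 0") (simp_all add: powr_diff)
    then have "c / \<sigma>\<^sup>2 * (\<tau> * ?D powr (1 / \<delta> - 1))\<^sup>2 * ?D\<^sup>2 = c / \<sigma>\<^sup>2 * (\<tau> * ?D powr (1 / \<delta>))\<^sup>2"
      by (metis mult.assoc power_mult_distrib)
    also have "\<dots> = B * (\<mu> * ?D powr (1 / \<delta>))\<^sup>2"
      by (simp add: B_def \<open>\<tau> = \<mu> / L\<close> power_mult_distrib power_divide)
    also have "\<dots> \<le> B * (g y - fstar)\<^sup>2"
      using eb[OF T_X[OF that(1)]] \<open>\<mu> > 0\<close> B by (intro mult_left_mono power_mono) auto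
    finally show ?thesis using step[OF that] by (simp add: left_diff_distrib)
  qed
  have step_T: "step y w \<in> T" if "y \<in> T" "w \<in> clarke_subdiff f y" for y w
  proof (rule T_mono[OF that(1)])
    show "step y w \<in> X"
      using T_X[OF that(1)] \<open>closed X\<close> \<open>X \<noteq> {}\<close> by (simp add: step_def closest_point_in_set)
    have "0 \<le> B * (g y - fstar)\<^sup>2" using B by simp
    then have "(infdist (step y w) ?M)\<^sup>2 \<le> (infdist y ?M)\<^sup>2"
      using step[OF that] by linarith
    then show "infdist (step y w) ?M \<le> infdist y ?M"
      by (rule power2_le_imp_le) (rule infdist_nonneg)
  qed

  define D where "D k = infdist (x k) ?M" for k
  have D_nonneg: "0 \<le> D k" for k by (simp add: D_def infdist_nonneg)
  have z: "\<zeta> k \<in> clarke_subdiff f (x k)" for k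
    using \<open>projected_subgradient f X \<alpha> x \<zeta>\<close> by (simp add: projected_subgradient_def)
  have x_Suc: "x (Suc k) = step (x k) (\<zeta> k)" for k
    using \<open>projected_subgradient f X \<alpha> x \<zeta>\<close> scaled_Polyak
    by (simp add: projected_subgradient_def step_def g_def)
  have x_T: "x k \<in> T" for k
    by (induction k) (use \<open>x 0 \<in> _\<close> in \<open>simp_all add: T_def[symmetric] x_Suc step_T z\<close>)
  have x_X: "x k \<in> X" for k using x_T T_X by blast
  define F where "F k = g (x k) - fstar" for k
  have descent: "(D (Suc k))\<^sup>2 \<le> (D k)\<^sup>2 - B * (F k)\<^sup>2" for k
    using step[OF x_T z] by (simp add: D_def F_def x_Suc)
  have contract: "(D (Suc k))\<^sup>2 \<le> (1 - c / \<sigma>\<^sup>2 * (\<tau> * D k powr (1 / \<delta> - 1))\<^sup>2) * (D k)\<^sup>2" for k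
    using contraction[OF x_T z] by (simp add: D_def x_Suc)
  have F_lim: "F \<longlonglongrightarrow> 0"
    using tendsto_zero_of_decrease[where E = "\<lambda>k. (D k)\<^sup>2", OF descent _ B] by simp
  have f_x: "f (x k) = ereal (fstar + F k)" for k
    using fg x_X \<open>X \<subseteq> X'\<close> by (auto simp: F_def)
  have f_lim: "(\<lambda>k. f (x k)) \<longlonglongrightarrow> ereal fstar"
  proof -
    have "(\<lambda>k. fstar + F k) \<longlonglongrightarrow> fstar + 0" by (intro tendsto_intros F_lim)
    then show ?thesis by (simp add: f_x)
  qed
  have D_le: "D k \<le> (F k / \<mu>) powr \<delta>" for k
  proof -
    have "D k powr (1 / \<delta>) \<le> F k / \<mu>"
      using eb[OF x_X] \<open>\<mu> > 0\<close> by (simp add: D_def F_def field_simps)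
    then have "(D k powr (1 / \<delta>)) powr \<delta> \<le> (F k / \<mu>) powr \<delta>"
      using \<delta> by (intro powr_mono2) auto
    then show ?thesis using \<delta> D_nonneg[of k] by (simp add: powr_powr)
  qed
  have D_lim: "D \<longlonglongrightarrow> 0"
  proof (rule tendsto_sandwich[OF _ _ tendsto_const])
    have "(\<lambda>k. (F k / \<mu>) powr \<delta>) \<longlonglongrightarrow> (0 / \<mu>) powr \<delta>"
      using \<open>\<mu> > 0\<close> \<delta> fstar_le[OF x_X]
      by (intro tendsto_powr' tendsto_intros F_lim) (auto simp: F_def)
    then show "(\<lambda>k. (F k / \<mu>) powr \<delta>) \<longlonglongrightarrow> 0" by simp
  qed (use D_le D_nonneg in auto)
  have D_dec: "decseq D"
  proof (rule decseq_SucI)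
    fix k
    have "0 \<le> B * (F k)\<^sup>2" using B by simp
    then have "(D (Suc k))\<^sup>2 \<le> (D k)\<^sup>2"
      using descent[of k] by linarith
    then show "D (Suc k) \<le> D k" by (rule power2_le_imp_le) (rule D_nonneg)
  qed

  have linear: "Q_linear_to_zero D (sqrt (1 - A))" if "\<delta> = 1" "?M \<noteq> X \<or> 0 \<le> 1 - A"
  proof -
    (* The contraction estimate at one point of the tube outside the set of minimizers shows that
       the radicand is nonnegative.  The sequence itself need not provide one, since it may start at
       a minimizer.  A point of X close to its nearest minimizer is found on a segment between
       a minimizer and a non-minimizer, and it has a subgradient because f is paraconvex. *)
    have rad: "0 \<le> 1 - A"
    proof (cases "?M = X")
      case False
      obtain y0 where y0: "y0 \<in> X" "y0 \<notin> ?M" using False M(1) by blast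
      obtain p where p: "p \<in> ?M" "infdist y0 ?M = dist y0 p"
        using infdist_attains_inf[OF \<open>closed ?M\<close> \<open>?M \<noteq> {}\<close>] by metis
      define d where "d = dist y0 p"
      have "0 < d" using y0 p(1) by (auto simp: d_def)
      define R where "R = (\<gamma> * \<mu> / \<rho>) powr (\<delta> / (\<delta> * (1 + \<nu>) - 1))"
      have "0 < R" using \<open>\<rho> > 0\<close> \<open>0 < \<gamma>\<close> \<open>\<mu> > 0\<close> by (simp add: R_def)
      define t where "t = min 1 (R / (2 * d))"
      have t: "0 < t" "t \<le> 1" using \<open>0 < R\<close> \<open>0 < d\<close> by (auto simp: t_def)
      have "t * d \<le> R / (2 * d) * d" using \<open>0 < d\<close> by (intro mult_right_mono) (auto simp: t_def)
      also have "\<dots> < R" using \<open>0 < d\<close> \<open>0 < R\<close> by simp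
      finally have "t * d < R" .
      define y where "y = (1 - t) *\<^sub>R p + t *\<^sub>R y0"
      have "y \<in> X"
        using \<open>convex X\<close> p(1) M(1) y0(1) t by (auto simp: y_def convex_alt)
      have "y - p = t *\<^sub>R (y0 - p)" "y0 - y = (1 - t) *\<^sub>R (y0 - p)"
        by (simp_all add: y_def algebra_simps)
      then have dist: "dist y p = t * d" "dist y0 y = (1 - t) * d"
        using t by (simp_all add: dist_norm d_def)
      have "infdist y ?M \<le> t * d"
        using infdist_le[OF p(1), of y] dist by simp
      then have "y \<in> T"
        using \<open>t * d < R\<close> \<open>y \<in> X\<close> by (simp add: T_def tube_def R_def)
      have "d \<le> infdist y ?M + (1 - t) * d"
        using infdist_triangle[of y0 ?M y] p(2) dist by (simp add: d_def)
      then have "t * d \<le> infdist y ?M" by (simp add: algebra_simps)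
      moreover have "0 < t * d" using t \<open>0 < d\<close> by simp
      ultimately have "0 < infdist y ?M" by linarith
      obtain w where "w \<in> clarke_subdiff f y"
        using paraconvex_clarke_subdiff_nonempty[OF pc \<open>open X'\<close> \<open>convex X'\<close>, of y] \<open>y \<in> X\<close> \<open>X \<subseteq> X'\<close>
          \<open>\<rho> > 0\<close> \<open>0 < \<nu>\<close> subdiff by fastforce
      from contraction[OF \<open>y \<in> T\<close> this]
      have "(infdist (step y w) ?M)\<^sup>2 \<le> (1 - A) * (infdist y ?M)\<^sup>2"
        using \<open>\<delta> = 1\<close> \<open>0 < infdist y ?M\<close> by (simp add: A_def)
      then have "0 \<le> (1 - A) * (infdist y ?M)\<^sup>2"
        using zero_le_power2 order_trans by blast
      then show ?thesis using \<open>0 < infdist y ?M\<close> by (simp add: zero_le_mult_iff)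
    qed (use that in simp)
    have "D (Suc k) \<le> sqrt (1 - A) * D k" for k
    proof (rule power2_le_imp_le)
      (* the case D k = 0 is separate because 0 powr 0 = 0 *)
      show "(D (Suc k))\<^sup>2 \<le> (sqrt (1 - A) * D k)\<^sup>2"
        using contract[of k] \<open>\<delta> = 1\<close> rad D_nonneg[of k]
        by (cases "D k = 0") (simp_all add: power_mult_distrib A_def)
      show "0 \<le> sqrt (1 - A) * D k" using rad D_nonneg by simp
    qed
    then show ?thesis
      using rad A D_nonneg by (simp add: Q_linear_to_zero_def)
  qed

  have sublinear: "\<exists>\<eta>>0. \<forall>\<^sub>F k in sequentially. (D k)\<^sup>2 \<le> \<eta> * real k powr (- (\<delta> / (1 - \<delta>)))"
    if "\<delta> < 1"
  proof -
    define q where "q = 1 / \<delta> - 1"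
    have q: "0 < q" "1 / q = \<delta> / (1 - \<delta>)"
      using \<open>\<delta> < 1\<close> \<delta> by (auto simp: q_def field_simps)
    have "(D (Suc k))\<^sup>2 \<le> (1 - A * (D k)\<^sup>2 powr q) * (D k)\<^sup>2" for k
    proof -
      have "(D k)\<^sup>2 powr q = (D k powr q)\<^sup>2"
        using D_nonneg[of k] by (simp add: power2_eq_square powr_mult)
      then show ?thesis
        using contract[of k] by (simp add: A_def q_def power_mult_distrib mult_ac)
    qed
    from superlinear_recursion_decay[where s = "\<lambda>k. (D k)\<^sup>2", OF _ this A q(1)]
    have "(D k)\<^sup>2 \<le> (q * A) powr (- (1 / q)) * real k powr (- (\<delta> / (1 - \<delta>)))" if "0 < k" for k
      using that q(2) by simp
    moreover have "0 < (q * A) powr (- (1 / q))" using q A by simp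
    ultimately show ?thesis
      by (intro exI[of _ "(q * A) powr (- (1 / q))"] conjI eventually_sequentiallyI[of 1]) auto
  qed

  have best: "Min ((\<lambda>i. f (x i)) ` {0..k}) - ereal fstar
      \<le> ereal (\<sigma> * L * D 0 / (sqrt c * sqrt (real (k + 1))))" for k
  proof -
    obtain i where i: "i \<le> k" "F i \<le> sqrt ((D 0)\<^sup>2 / (B * real (k + 1)))"
      using best_value_of_decrease[where E = "\<lambda>k. (D k)\<^sup>2", OF descent _ B] by auto
    have "(D 0)\<^sup>2 / (B * real (k + 1)) = (\<sigma> * L * D 0)\<^sup>2 / (c * real (k + 1))"
      by (simp add: B_def power_mult_distrib)
    then have "sqrt ((D 0)\<^sup>2 / (B * real (k + 1))) = \<sigma> * L * D 0 / (sqrt c * sqrt (real (k + 1)))"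
      using D_nonneg[of 0] \<open>0 < L\<close> \<open>\<sigma> > 1 / 2\<close>
      by (simp add: real_sqrt_divide real_sqrt_mult real_sqrt_abs abs_mult)
    then have F: "F i \<le> \<sigma> * L * D 0 / (sqrt c * sqrt (real (k + 1)))" using i(2) by simp
    have "Min ((\<lambda>i. f (x i)) ` {0..k}) - ereal fstar \<le> f (x i) - ereal fstar"
      using i(1) by (intro ereal_minus_mono Min_le) auto
    also have "\<dots> = ereal (F i)" by (simp add: f_x)
    finally show ?thesis using F by (meson ereal_less_eq(3) order_trans)
  qed

  show ?thesis
    using x_T contract D_dec D_lim f_lim linear sublinear best
    unfolding T_def D_def[abs_def] c_def A_def by (intro conjI) simp_all
qed

end
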